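(* Let $d\ge 3$ and let $j$ be an integer with $d\le j\le \left\lfloor \frac{3(d-1)}{2}\right\rfloor$. (a) If $d$ is odd and $j-d$ is even, then $\operatorname{triv}(d,j)=\left\lfloor \frac{3d-2j-3}{6}\right\rfloor$ and $\operatorname{sign}(d,j)=\left\lfloor \frac{3d-2j-3}{6}\right\rfloor+1$. (b) If $d$ is odd and $j-d$ is odd, then $\operatorname{triv}(d,j)=\left\lfloor \frac{3d-2j-3}{6}\right\rfloor+1$ and $\operatorname{sign}(d,j)=\left\lfloor \frac{3d-2j-3}{6}\right\rfloor$. (c) If $d$ is even, then $\operatorname{triv}(d,j)=\operatorname{sign}(d,j)=\left\lfloor \frac{3d-2j}{6}\right\rfloor$.
   Context: $\Bbbk$ is an algebraically closed field of characteristic $0$. For an integer $d\ge 1$, $A(d)=\Bbbk[x_1,x_2,x_3]/(x_1^d,x_2^d,x_3^d)=\bigoplus_j A(d)_j$ with its standard grading. $S_3$ acts on $A(d)$ by permuting variables. The linear map $E:A(d)_{j+1}\to A(d)_j$ is defined on the monomial basis by $E(x_1^{a_1}x_2^{a_2}x_3^{a_3})=\sum_{k=1}^{3} a_k(d-a_k)\,x_1^{a_1}\cdots x_k^{a_k-1}\cdots x_3^{a_3}$; it commutes with the $S_3$-action. $\operatorname{triv}(d,j)$ and $\operatorname{sign}(d,j)$ denote the multiplicities of the trivial and sign representations of $S_3$ in $\operatorname{Ker}(E)\cap A(d)_j$. *)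

theory Defs
  imports Complex_Main "HOL-Computational_Algebra.Polynomial" "HOL-Combinatorics.Permutations" "HOL-Library.Function_Algebras"
begin

text \<open>Monomials x1^(a 0) x2^(a 1) x3^(a 2) of A(d) of degree j, encoded by exponent
  functions a :: nat => nat vanishing outside {0,1,2}.\<close>
definition mons :: "nat \<Rightarrow> nat \<Rightarrow> (nat \<Rightarrow> nat) set" where
  "mons d j = {a. (\<forall>i\<ge>3. a i = 0) \<and> (\<forall>i<3. a i < d) \<and> a 0 + a 1 + a 2 = j}"

text \<open>The graded piece A(d)_j: coefficient functions supported on the monomial basis.\<close>
definition Apiece :: "nat \<Rightarrow> nat \<Rightarrow> ((nat \<Rightarrow> nat) \<Rightarrow> 'k::field) set" where
  "Apiece d j = {f. \<forall>a. a \<notin> mons d j \<longrightarrow> f a = 0}"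

definition cscale :: "'k::field \<Rightarrow> ((nat \<Rightarrow> nat) \<Rightarrow> 'k) \<Rightarrow> ((nat \<Rightarrow> nat) \<Rightarrow> 'k)" where
  "cscale c f = (\<lambda>a. c * f a)"

definition monom_vec :: "(nat \<Rightarrow> nat) \<Rightarrow> ((nat \<Rightarrow> nat) \<Rightarrow> 'k::field)" where
  "monom_vec b = (\<lambda>c. if c = b then 1 else 0)"

text \<open>E restricted to A(d)_j (so E : A(d)_j -> A(d)_(j-1)), extended linearly from
  E(x^a) = sum_k a_k (d - a_k) x^(a - e_k).\<close>
definition Emap :: "nat \<Rightarrow> nat \<Rightarrow> ((nat \<Rightarrow> nat) \<Rightarrow> 'k::field) \<Rightarrow> ((nat \<Rightarrow> nat) \<Rightarrow> 'k)" where
  "Emap d j f = (\<lambda>b. \<Sum>a\<in>mons d j. f a *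
      (\<Sum>k<3. of_nat (a k * (d - a k)) * monom_vec (a(k := a k - 1)) b))"

definition kerE :: "nat \<Rightarrow> nat \<Rightarrow> ((nat \<Rightarrow> nat) \<Rightarrow> 'k::field) set" where
  "kerE d j = {f \<in> Apiece d j. \<forall>b. Emap d j f b = 0}"

definition perm_act :: "(nat \<Rightarrow> nat) \<Rightarrow> ((nat \<Rightarrow> nat) \<Rightarrow> 'k) \<Rightarrow> ((nat \<Rightarrow> nat) \<Rightarrow> 'k)" where
  "perm_act \<sigma> f = (\<lambda>a. f (a \<circ> \<sigma>))"

text \<open>Multiplicity of the one-dimensional character chi in an S_3-stable subspace V:
  dim Hom_S3(chi, V) = dim of the chi-isotypic subspace.\<close>
definition char_mult :: "((nat \<Rightarrow> nat) \<Rightarrow> 'k::field) \<Rightarrow> ((nat \<Rightarrow> nat) \<Rightarrow> 'k) set \<Rightarrow> nat" where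
  "char_mult chi V = vector_space.dim cscale
     {f \<in> V. \<forall>\<sigma>. \<sigma> permutes {0..<3} \<longrightarrow> perm_act \<sigma> f = cscale (chi \<sigma>) f}"

definition triv :: "'k::field itself \<Rightarrow> nat \<Rightarrow> nat \<Rightarrow> nat" where
  "triv _ d j = char_mult (\<lambda>\<sigma>. 1::'k) (kerE d j)"

definition sign_mult :: "'k::field itself \<Rightarrow> nat \<Rightarrow> nat \<Rightarrow> nat" where
  "sign_mult _ d j = char_mult (\<lambda>\<sigma>. of_int (sign \<sigma>) :: 'k) (kerE d j)"

end

theory Submission
  imports Defs
begin

text \<open>
  Let \<open>F\<close> be multiplication by \<open>x1 + x2 + x3\<close>. Then \<open>E F - F E\<close> acts on \<open>A(d)_i\<close> as the scalar
  \<open>3(d-1) - 2i\<close>, and \<open>E\<close>, \<open>F\<close> commute with \<open>S_3\<close>; hence \<open>E\<close> maps each isotypic part of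
  \<open>A(d)_(i+1)\<close> onto that of \<open>A(d)_i\<close> whenever \<open>2i < 3(d-1)\<close>. So the multiplicity of a character in
  \<open>Ker E\<close> is the difference of its multiplicities in \<open>A(d)_j\<close> and \<open>A(d)_(j-1)\<close>. These count the
  exponent triples \<open>a 0 \<ge> a 1 \<ge> a 2\<close> (trivial) or \<open>a 0 > a 1 > a 2\<close> (sign), and incrementing
  \<open>a 0\<close> reduces the difference to two counts in one variable.
\<close>

subsection \<open>Linear algebra\<close>

context vector_space_pair
begin

text \<open>Rank-nullity on a subspace \<open>V\<close> of a possibly infinite-dimensional space;
  the finite set \<open>T\<close> supplies finiteness. A basis \<open>B\<close> of the kernel
  extends to a basis \<open>C\<close> of \<open>V\<close>, and \<open>f\<close> carries
  \<open>C - B\<close> injectively onto a basis of the image.\<close>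

lemma dim_kernel_plus_dim_image:
  assumes f: "Vector_Spaces.linear s1 s2 f" and V: "vs1.subspace V" and T: "finite T" "V \<subseteq> vs1.span T"
  shows "vs1.dim V = vs1.dim {v \<in> V. f v = 0} + vs2.dim (f ` V)"
proof -
  let ?K = "{v \<in> V. f v = 0}"
  obtain B where B: "B \<subseteq> ?K" "vs1.independent B" "?K \<subseteq> vs1.span B"
    by (rule vs1.maximal_independent_subset)
  have "B \<subseteq> V" using B(1) by auto
  then obtain C where C: "B \<subseteq> C" "C \<subseteq> V" "vs1.independent C" "V \<subseteq> vs1.span C"
    by (rule vs1.maximal_independent_subset_extend[OF _ B(2)])
  have finC: "finite C"
    using vs1.independent_span_bound[OF T(1) C(3) subset_trans[OF C(2) T(2)]] by simp
  \<comment> \<open>Such an \<open>x\<close> also lies in the kernel, hence in the span of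
    \<open>B\<close>. Its coordinates in \<open>C\<close> are then supported both in
    \<open>B\<close> and in \<open>C - B\<close>, so they all vanish.\<close>
  have "x = 0" if x: "x \<in> vs1.span (C - B)" "f x = 0" for x
  proof (rule ccontr)
    assume "x \<noteq> 0"
    have "x \<in> V"
      using x(1) vs1.span_minimal[OF _ V] C(2) by blast
    then have "x \<in> vs1.span B"
      using B(3) x(2) by blast
    have rep: "vs1.representation C x = vs1.representation D x"
      if "D \<subseteq> C" "x \<in> vs1.span D" for D
      using vs1.representation_extend[OF C(3)] that by blast
    have "\<exists>b. vs1.representation C x b \<noteq> 0"
    proof (rule ccontr)
      assume "\<nexists>b. vs1.representation C x b \<noteq> 0"
      then show False
        using vs1.sum_nonzero_representation_eq[OF C(3), of x] \<open>x \<noteq> 0\<close> \<open>x \<in> V\<close> C(4) by auto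
    qed
    then obtain b where b: "vs1.representation C x b \<noteq> 0" ..
    then have "b \<in> B" "b \<in> C - B"
      using rep[OF C(1) \<open>x \<in> vs1.span B\<close>] rep[OF _ x(1)] vs1.representation_ne_zero[of C x b]
        vs1.representation_ne_zero[of B x b] vs1.representation_ne_zero[of "C - B" x b]
      by auto
    then show False by simp
  qed
  then have inj: "inj_on f (vs1.span (C - B))"
    by (simp add: linear_inj_on_iff_eq_0[OF f])
  have ind: "vs2.independent (f ` (C - B))"
    using linear_independent_injective_image[OF f vs1.independent_mono[OF C(3)] inj] by simp
  have "f ` V \<subseteq> vs2.span (f ` (C - B))"
  proof -
    have "f ` C \<subseteq> vs2.span (f ` (C - B))"
    proof (rule image_subsetI)
      fix c assume "c \<in> C"
      show "f c \<in> vs2.span (f ` (C - B))"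
      proof (cases "c \<in> B")
        case True
        then have "f c = 0" using B(1) by auto
        then show ?thesis by (simp add: vs2.span_zero)
      next
        case False
        with \<open>c \<in> C\<close> show ?thesis by (intro vs2.span_base) simp
      qed
    qed
    then have "f ` vs1.span C \<subseteq> vs2.span (f ` (C - B))"
      using vs2.span_minimal[OF _ vs2.subspace_span] linear_span_image[OF f, of C] by metis
    with C(4) show ?thesis by blast
  qed
  then have "vs2.dim (f ` V) = card (f ` (C - B))"
    using vs2.basis_card_eq_dim[OF _ _ ind] C(2) by (metis Diff_subset image_mono subset_trans)
  also have "\<dots> = card (C - B)"
    using inj by (intro card_image) (meson inj_on_subset vs1.span_superset)
  also have "\<dots> = card C - card B"
    using C(1) finC by (simp add: card_Diff_subset finite_subset)
  finally show ?thesis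
    using vs1.basis_card_eq_dim[OF B(1,3,2)] vs1.basis_card_eq_dim[OF C(2,4,3)]
      card_mono[OF finC C(1)] by simp
qed

end

lemma sum_fun_apply: "(\<Sum>i\<in>A. f i) x = (\<Sum>i\<in>A. f i x)"
  for f :: "'i \<Rightarrow> 'a \<Rightarrow> 'b::comm_monoid_add"
  by (induction A rule: infinite_finite_induct) auto

interpretation fs: vector_space "cscale :: 'k::field \<Rightarrow> ((nat \<Rightarrow> nat) \<Rightarrow> 'k) \<Rightarrow> _"
  by unfold_locales (auto simp: cscale_def fun_eq_iff algebra_simps)

interpretation fsp: vector_space_pair "cscale :: 'k::field \<Rightarrow> ((nat \<Rightarrow> nat) \<Rightarrow> 'k) \<Rightarrow> _"
  "cscale :: 'k::field \<Rightarrow> ((nat \<Rightarrow> nat) \<Rightarrow> 'k) \<Rightarrow> _" ..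

text \<open>Up to nonzero scalars, the vectors \<open>e a\<close> are dual to evaluation at the
  points of \<open>D\<close>. Subtracting from \<open>v\<close> the combination with coefficients
  \<open>v a / e a a\<close> leaves an element of \<open>V\<close> vanishing on \<open>D\<close>,
  hence 0; evaluation also gives independence.\<close>

lemma dual_basis:
  fixes V :: "((nat \<Rightarrow> nat) \<Rightarrow> 'k::field) set"
  assumes V: "fs.subspace V" and D: "finite D"
    and inj: "\<And>f. f \<in> V \<Longrightarrow> (\<And>a. a \<in> D \<Longrightarrow> f a = 0) \<Longrightarrow> f = 0"
    and e: "\<And>a. a \<in> D \<Longrightarrow> e a \<in> V" "\<And>a. a \<in> D \<Longrightarrow> e a a \<noteq> 0"
      "\<And>a b. a \<in> D \<Longrightarrow> b \<in> D \<Longrightarrow> a \<noteq> b \<Longrightarrow> e a b = 0"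
  shows "V \<subseteq> fs.span (e ` D)" and "fs.dim V = card D"
proof -
  have inj_e: "inj_on e D"
    using e by (metis inj_onI)
  have eval: "(\<Sum>a\<in>D. cscale (c a) (e a)) b = c b * e b b" if "b \<in> D" for c b
  proof -
    have "(\<Sum>a\<in>D. cscale (c a) (e a)) b = (\<Sum>a\<in>D. if a = b then c b * e b b else 0)"
      unfolding sum_fun_apply using e(3) that by (intro sum.cong) (auto simp: cscale_def)
    then show ?thesis using D that by simp
  qed
  show sp: "V \<subseteq> fs.span (e ` D)"
  proof
    fix v assume v: "v \<in> V"
    let ?s = "\<Sum>a\<in>D. cscale (v a / e a a) (e a)"
    have "?s \<in> V"
      using e(1) by (intro fs.subspace_sum[OF V] fs.subspace_scale[OF V]) auto
    then have "v - ?s = 0"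
      using e(2) v by (intro inj fs.subspace_diff[OF V]) (auto simp: eval)
    then have "v = ?s" by simp
    also have "\<dots> \<in> fs.span (e ` D)"
      by (intro fs.span_sum fs.span_scale fs.span_base) auto
    finally show "v \<in> fs.span (e ` D)" .
  qed
  have "fs.independent (e ` D)"
  proof (rule fs.independent_if_scalars_zero)
    fix c x assume c: "(\<Sum>x\<in>e ` D. cscale (c x) x) = 0" and "x \<in> e ` D"
    then obtain b where b: "b \<in> D" "x = e b" by blast
    have "(\<Sum>a\<in>D. cscale (c (e a)) (e a)) = 0"
      using c by (simp add: sum.reindex[OF inj_e])
    then have "c (e b) * e b b = 0"
      using eval[OF b(1), of "\<lambda>a. c (e a)"] by simp
    with b e(2) show "c x = 0" by simp
  qed (use D in simp)
  then have "card (e ` D) = fs.dim V"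
    using e(1) sp by (intro fs.basis_card_eq_dim) auto
  then show "fs.dim V = card D"
    by (simp add: card_image[OF inj_e])
qed

subsection \<open>The operators E and F\<close>

text \<open>\<open>E\<close> read off at the target monomial \<open>b\<close>, whose sources are
  \<open>b\<close> with one exponent incremented; this form is independent of the degree. Truncated
  subtraction makes the weight 0 as soon as \<open>b k + 1 >= d\<close>.\<close>

definition lower :: "nat \<Rightarrow> ((nat \<Rightarrow> nat) \<Rightarrow> 'k::field) \<Rightarrow> ((nat \<Rightarrow> nat) \<Rightarrow> 'k)" where
  "lower d f = (\<lambda>b. \<Sum>k<3. of_nat ((b k + 1) * (d - (b k + 1))) * f (b(k := b k + 1)))"

text \<open>A product that leaves the monomial basis is \<open>0\<close> in \<open>A(d)\<close>, whence the outer condition.\<close>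
definition raise :: "nat \<Rightarrow> ((nat \<Rightarrow> nat) \<Rightarrow> 'k::field) \<Rightarrow> ((nat \<Rightarrow> nat) \<Rightarrow> 'k)" where
  "raise d f = (\<lambda>b. if \<forall>i<3. b i < d
     then \<Sum>k<3. if b k = 0 then 0 else f (b(k := b k - 1)) else 0)"

lemma all_less_3: "(\<forall>i<3::nat. P i) \<longleftrightarrow> P 0 \<and> P 1 \<and> P 2"
  by (auto simp: numeral_3_eq_3 numeral_2_eq_2 less_Suc_eq)

lemma sum_less_3: "(\<Sum>k<3::nat. g k) = g 0 + g 1 + (g 2 :: 'a::comm_monoid_add)"
  by (simp add: numeral_3_eq_3 numeral_2_eq_2)

lemma finite_mons: "finite (mons d j)"
proof (rule finite_subset)
  show "finite {a. \<forall>x. (x \<in> {..<3::nat} \<longrightarrow> a x \<in> {..<d}) \<and> (x \<notin> {..<3} \<longrightarrow> a x = 0)}"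
    by (intro finite_set_of_finite_funs) auto
qed (auto simp: mons_def)

lemma Emap_eq_lower:
  assumes f: "f \<in> Apiece d j"
  shows "Emap d j f = lower d f"
proof
  fix b
  have "(\<Sum>a\<in>mons d j. f a * (of_nat (a k * (d - a k)) * monom_vec (a(k := a k - 1)) b)) =
        of_nat ((b k + 1) * (d - (b k + 1))) * f (b(k := b k + 1))" for k
  proof -
    let ?b = "b(k := b k + 1)"
    have "f a * (of_nat (a k * (d - a k)) * monom_vec (a(k := a k - 1)) b) =
        (if a = ?b then of_nat (?b k * (d - ?b k)) * f ?b else 0)" for a
    \<comment> \<open>If \<open>a k = 0\<close>, the weight is 0 and \<open>a\<close> cannot equal
      \<open>?b\<close>; otherwise \<open>b\<close> determines \<open>a\<close>.\<close>
    proof (cases "a k = 0")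
      case False
      then have "b = a(k := a k - 1) \<longleftrightarrow> a = ?b"
        by (auto simp: fun_eq_iff)
      then show ?thesis by (auto simp: monom_vec_def algebra_simps)
    qed (auto simp: fun_eq_iff)
    then show ?thesis
      using f by (auto simp: Apiece_def finite_mons)
  qed
  note * = this
  have "Emap d j f b = (\<Sum>k<3. \<Sum>a\<in>mons d j. f a * (of_nat (a k * (d - a k)) * monom_vec (a(k := a k - 1)) b))"
    unfolding Emap_def sum_distrib_left by (rule sum.swap)
  then show "Emap d j f b = lower d f b"
    unfolding * lower_def .
qed

lemma linear_lower: "Vector_Spaces.linear cscale cscale (lower d)"
  unfolding Vector_Spaces.linear_iff
  by (auto simp: fs.vector_space_axioms lower_def cscale_def fun_eq_iff sum.distrib sum_distrib_left algebra_simps)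

lemma linear_raise: "Vector_Spaces.linear cscale cscale (raise d)"
  unfolding Vector_Spaces.linear_iff
  by (auto simp: fs.vector_space_axioms raise_def cscale_def fun_eq_iff sum_less_3 algebra_simps)

lemma Apiece_supp: "f \<in> Apiece d j \<Longrightarrow> f a \<noteq> 0 \<Longrightarrow> a \<in> mons d j"
  by (auto simp: Apiece_def)

lemma lower_Apiece:
  assumes "f \<in> Apiece d (Suc j)"
  shows "lower d f \<in> Apiece d j"
  unfolding Apiece_def
proof (safe, rule ccontr)
  fix b assume b: "b \<notin> mons d j" "lower d f b \<noteq> 0"
  then obtain k where k: "k < 3" "f (b(k := b k + 1)) \<noteq> 0"
    unfolding lower_def by (metis (no_types, lifting) lessThan_iff mult_zero_right sum.neutral)
  then have "b(k := b k + 1) \<in> mons d (Suc j)"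
    using Apiece_supp[OF assms] by blast
  moreover from k(1) have "k = 0 \<or> k = 1 \<or> k = 2" by auto
  ultimately have "b \<in> mons d j"
    by (auto simp: mons_def all_less_3 split: if_splits)
  with b(1) show False ..
qed

lemma lower_Apiece_0:
  assumes "f \<in> Apiece d 0"
  shows "lower d f = 0"
proof -
  have "f (b(k := b k + 1)) = 0" if "k < 3" for b k
  proof (rule ccontr)
    assume "f (b(k := b k + 1)) \<noteq> 0"
    then have "b(k := b k + 1) \<in> mons d 0"
      using Apiece_supp[OF assms] by blast
    moreover from that have "k = 0 \<or> k = 1 \<or> k = 2" by auto
    ultimately show False by (auto simp: mons_def)
  qed
  then show ?thesis by (auto simp: lower_def fun_eq_iff intro!: sum.neutral)
qed

lemma raise_Apiece:
  assumes "f \<in> Apiece d j"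
  shows "raise d f \<in> Apiece d (Suc j)"
  unfolding Apiece_def
proof (safe, rule ccontr)
  fix b assume b: "b \<notin> mons d (Suc j)" "raise d f b \<noteq> 0"
  have lt: "\<forall>i<3. b i < d"
    using b(2) unfolding raise_def by presburger
  then have "(\<Sum>k<3. if b k = 0 then 0 else f (b(k := b k - 1))) \<noteq> 0"
    using b(2) by (simp add: raise_def)
  then obtain k where k: "k < 3" "b k \<noteq> 0" "f (b(k := b k - 1)) \<noteq> 0"
    by (rule sum.not_neutral_contains_not_neutral) (auto split: if_splits)
  then have "b(k := b k - 1) \<in> mons d j"
    using Apiece_supp[OF assms] by blast
  moreover from k(1) have "k = 0 \<or> k = 1 \<or> k = 2" by auto
  ultimately have "b \<in> mons d (Suc j)"
    using lt k(2) by (auto simp: mons_def all_less_3 split: if_splits)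
  with b(1) show False ..
qed

text \<open>The sl2 commutator relation. Terms that raise and lower different variables agree in
  \<open>E F\<close> and \<open>F E\<close>; for the same variable the difference is (b_k + 1)(d -
  b_k - 1) - b_k (d - b_k) = d - 1 - 2 b_k, and these sum to 3(d-1) - 2i. The bound on
  \<open>i\<close> makes the natural subtraction exact.\<close>

lemma lower_raise:
  fixes f :: "(nat \<Rightarrow> nat) \<Rightarrow> 'k::field"
  assumes f: "f \<in> Apiece d i" and i: "2 * i \<le> 3 * (d - 1)"
  shows "lower d (raise d f) = raise d (lower d f) + cscale (of_nat (3 * (d - 1) - 2 * i)) f"
proof
  fix b
  show "lower d (raise d f) b = (raise d (lower d f) + cscale (of_nat (3 * (d - 1) - 2 * i)) f) b"
  proof (cases "\<forall>k<3. b k < d")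
    case False
    then have "raise d f (b(k := b k + 1)) = 0" for k
      unfolding raise_def by (metis add_lessD1 fun_upd_apply)
    moreover have "f b = 0"
      using False Apiece_supp[OF f] by (auto simp: mons_def)
    moreover have "raise d (lower d f) b = 0"
      using False by (auto simp: raise_def)
    ultimately show ?thesis by (simp add: lower_def cscale_def)
  next
    case True
    \<comment> \<open>\<open>?u k l\<close> and \<open>?v k l\<close> are the contributions to
      \<open>E F\<close> and \<open>F E\<close> in which \<open>E\<close> acts on variable
      \<open>k\<close> and \<open>F\<close> on variable \<open>l\<close>; \<open>?c k\<close> is
      their difference for \<open>k = l\<close>.\<close>
    let ?w = "\<lambda>n. of_nat ((n + 1) * (d - (n + 1))) :: 'k"
    let ?u = "\<lambda>k l. ?w (b k) * (if (b(k := b k + 1)) l = 0 then 0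
       else f (b(k := b k + 1, l := (b(k := b k + 1)) l - 1)))"
    let ?v = "\<lambda>k l. if b l = 0 then 0 else
       ?w ((b(l := b l - 1)) k) * f (b(l := b l - 1, k := (b(l := b l - 1)) k + 1))"
    let ?c = "\<lambda>k. (of_nat d - 1 - 2 * of_nat (b k)) * f b"
    have R: "?w (b k) * raise d f (b(k := b k + 1)) = (\<Sum>l<3. ?u k l)" if "k < 3" for k
    proof (cases "b k + 1 < d")
      case lt: True
      have "\<forall>i<3. (b(k := b k + 1)) i < d" using True lt by simp
      then show ?thesis by (simp only: raise_def sum_distrib_left if_P)
    next
      \<comment> \<open>Here \<open>raise\<close> is cut off to 0 while the sum inside
        \<open>?u\<close> is not, but the weight of \<open>E\<close> vanishes, so both sides are
        0.\<close>
      case False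
      then have "d - (b k + 1) = 0" by simp
      then show ?thesis by simp
    qed
    have uv: "?u k l = ?v k l + (if k = l then ?c k else 0)" if "k < 3" for k l
    proof (cases "k = l")
      case False
      then show ?thesis by (simp add: fun_upd_twist)
    next
      case kl: True
      have u: "?u k k = ?w (b k) * f b" by simp
      have "b k < d" using True that by blast
      then obtain m where m: "d = b k + 1 + m"
        using less_imp_Suc_add by auto
      show ?thesis
      proof (cases "b k")
        case 0
        then have v: "?v k k = 0" by simp
        from 0 m have "?w (b k) * f b = ?c k" by simp
        then show ?thesis
          unfolding kl[symmetric] u v by (simp only: if_True simp_thms add_0)
      next
        case (Suc n)
        then have "b(k := n, k := Suc n) = b" by auto
        then have v: "?v k k = ?w n * f b" using Suc by simp
        have "?w (b k) = ?w n + (of_nat d - 1 - 2 * of_nat (b k))"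
          unfolding m Suc by (simp add: algebra_simps)
        then have "?w (b k) * f b = ?w n * f b + ?c k"
          by (simp only: distrib_right)
        then show ?thesis
          unfolding kl[symmetric] u v by (simp only: if_True simp_thms)
      qed
    qed
    have "lower d (raise d f) b = (\<Sum>k<3. ?w (b k) * raise d f (b(k := b k + 1)))"
      by (simp add: lower_def)
    also have "\<dots> = (\<Sum>k<3. \<Sum>l<3. ?u k l)"
      using R by (intro sum.cong) auto
    also have "\<dots> = (\<Sum>k<3. \<Sum>l<3. ?v k l + (if k = l then ?c k else 0))"
      using uv by (intro sum.cong) auto
    also have "\<dots> = (\<Sum>l<3. \<Sum>k<3. ?v k l) + (\<Sum>k<3. ?c k)"
      by (simp add: sum.distrib sum.swap[of "\<lambda>k l. ?v k l"])
    also have "(\<Sum>l<3. \<Sum>k<3. ?v k l) = raise d (lower d f) b"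
      using True by (auto simp: raise_def lower_def intro!: sum.cong)
    also have "(\<Sum>k<3. ?c k) = of_nat (3 * (d - 1) - 2 * i) * f b"
    proof (cases "f b = 0")
      case False
      then have "i = b 0 + b 1 + b 2"
        using Apiece_supp[OF f] by (auto simp: mons_def)
      moreover have "0 < d" using True by fastforce
      then obtain m where "d = Suc m" by (cases d) auto
      ultimately show ?thesis using i by (simp add: sum_less_3 of_nat_diff algebra_simps)
    qed simp
    finally show ?thesis by (simp add: cscale_def)
  qed
qed

subsection \<open>The action of S_3\<close>

lemma permutes_3_cases:
  assumes "\<sigma> permutes {0..<3::nat}"
  shows "(\<sigma> 0, \<sigma> 1, \<sigma> 2) \<in> {(0,1,2), (0,2,1), (1,0,2), (1,2,0), (2,0,1), (2,1,0)}"
    and "i \<ge> 3 \<Longrightarrow> \<sigma> i = i"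
proof -
  have "\<sigma> i < 3" if "i < 3" for i
    using permutes_in_image[OF assms, of i] that by simp
  then have "\<sigma> 0 < 3" "\<sigma> 1 < 3" "\<sigma> 2 < 3" by auto
  then have "\<sigma> 0 \<in> {0,1,2}" "\<sigma> 1 \<in> {0,1,2}" "\<sigma> 2 \<in> {0,1,2}" by auto
  moreover have "\<sigma> 0 \<noteq> \<sigma> 1" "\<sigma> 0 \<noteq> \<sigma> 2" "\<sigma> 1 \<noteq> \<sigma> 2"
    using permutes_inj[OF assms] by (simp_all add: inj_eq)
  ultimately show "(\<sigma> 0, \<sigma> 1, \<sigma> 2) \<in> {(0,1,2), (0,2,1), (1,0,2), (1,2,0), (2,0,1), (2,1,0)}"
    by (elim insertE emptyE; simp)
  show "\<sigma> i = i" if "i \<ge> 3"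
    using permutes_not_in[OF assms, of i] that by simp
qed

lemma mons_comp:
  assumes "\<sigma> permutes {0..<3}" "a \<in> mons d j"
  shows "a \<circ> \<sigma> \<in> mons d j"
  using permutes_3_cases[OF assms(1)] assms(2) by (auto simp: mons_def all_less_3)

text \<open>Allows the sums over the three variables in \<open>lower\<close> and
  \<open>raise\<close> to be reindexed by \<open>\<sigma>\<close>: changing exponent
  \<open>\<sigma> k\<close> of \<open>b\<close> means changing exponent \<open>k\<close> of
  \<open>b \<circ> \<sigma>\<close>.\<close>

lemma perm_act_upd:
  assumes "\<sigma> permutes {0..<3}"
  shows "perm_act \<sigma> f (b(\<sigma> k := c)) = f ((b \<circ> \<sigma>)(k := c))"
proof -
  have "b(\<sigma> k := c) \<circ> \<sigma> = (b \<circ> \<sigma>)(k := c)"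
    using permutes_inj[OF assms] by (auto simp: fun_eq_iff inj_eq)
  then show ?thesis by (simp add: perm_act_def)
qed

lemma sum_permute_3:
  assumes "\<sigma> permutes {0..<3::nat}"
  shows "(\<Sum>k<3. g (\<sigma> k)) = (\<Sum>k<3. g k)"
  using sum.permute[OF assms, of g] by (simp add: lessThan_atLeast0 comp_def)

lemma lower_perm_act:
  assumes "\<sigma> permutes {0..<3}"
  shows "lower d (perm_act \<sigma> f) = perm_act \<sigma> (lower d f)"
proof
  fix b
  show "lower d (perm_act \<sigma> f) b = perm_act \<sigma> (lower d f) b"
    unfolding lower_def
    by (subst sum_permute_3[OF assms, symmetric])
      (simp only: perm_act_upd[OF assms], simp add: perm_act_def)
qed

lemma raise_perm_act:
  assumes "\<sigma> permutes {0..<3}"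
  shows "raise d (perm_act \<sigma> f) = perm_act \<sigma> (raise d f)"
proof
  fix b
  have "(\<forall>i<3. b (\<sigma> i) < d) \<longleftrightarrow> (\<forall>i<3. b i < d)"
    using permutes_3_cases(1)[OF assms] by (auto simp: all_less_3)
  then show "raise d (perm_act \<sigma> f) b = perm_act \<sigma> (raise d f) b"
    unfolding raise_def
    by (subst sum_permute_3[OF assms, symmetric])
      (simp only: perm_act_upd[OF assms], simp add: perm_act_def cong: if_cong)
qed

subsection \<open>Isotypic parts\<close>

text \<open>A fundamental domain: each S_3-orbit of exponent triples meets it in exactly one
  point.\<close>

definition dominant :: "nat \<Rightarrow> nat \<Rightarrow> (nat \<Rightarrow> nat) set" where
  "dominant d j = {a \<in> mons d j. a 2 \<le> a 1 \<and> a 1 \<le> a 0}"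

lemma dominant_exists:
  assumes "a \<in> mons d j"
  obtains \<sigma> where "\<sigma> permutes {0..<3}" "a \<circ> \<sigma> \<in> dominant d j"
proof -
  let ?s = "transpose (0::nat) 1" and ?t = "transpose (1::nat) 2"
  have s: "?s permutes {0..<3}" and t: "?t permutes {0..<3}"
    by (auto intro: permutes_swap_id)
  have "\<exists>\<sigma>. \<sigma> permutes {0..<3} \<and> a (\<sigma> 2) \<le> a (\<sigma> 1) \<and> a (\<sigma> 1) \<le> a (\<sigma> 0)"
  proof (rule ccontr)
    assume none: "\<not> ?thesis"
    have "id permutes {0..<3::nat}" by (rule permutes_id)
    \<comment> \<open>All six elements of S_3, as words in two adjacent transpositions. If none of
      them sorted \<open>a\<close>, linearity of the order would be violated.\<close>
    note perms = this s t permutes_compose[OF s t] permutes_compose[OF t s]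
      permutes_compose[OF s permutes_compose[OF t s]]
    have "\<not> (a (\<sigma> 2) \<le> a (\<sigma> 1) \<and> a (\<sigma> 1) \<le> a (\<sigma> 0))" if "\<sigma> permutes {0..<3}" for \<sigma>
      using none that by blast
    from this[OF perms(1)] this[OF perms(2)] this[OF perms(3)] this[OF perms(4)]
      this[OF perms(5)] this[OF perms(6)]
    show False by (simp add: transpose_def) (meson nat_le_linear)
  qed
  with mons_comp[OF _ assms] that show thesis
    by (auto simp: dominant_def)
qed

lemma dominant_unique:
  assumes "\<sigma> permutes {0..<3}" "a \<in> dominant d j" "a \<circ> \<sigma> \<in> dominant d j"
  shows "a \<circ> \<sigma> = a"
proof
  fix i :: nat
  consider "i = 0" | "i = 1" | "i = 2" | "i \<ge> 3" by linarith
  then show "(a \<circ> \<sigma>) i = a i"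
    using permutes_3_cases[OF assms(1)] assms(2,3) by cases (auto simp: dominant_def)
qed

text \<open>A one-dimensional character of S_3, so that the trivial and sign cases share one
  argument. Characteristic 0 keeps the scalars to be inverted and the orders of stabilizers
  nonzero.\<close>

locale s3_character =
  fixes chi :: "(nat \<Rightarrow> nat) \<Rightarrow> 'k::field_char_0"
  assumes chi_id: "chi id = 1"
    and chi_comp: "\<sigma> permutes {0..<3} \<Longrightarrow> \<tau> permutes {0..<3} \<Longrightarrow> chi (\<sigma> \<circ> \<tau>) = chi \<sigma> * chi \<tau>"
begin

definition isotypic :: "nat \<Rightarrow> nat \<Rightarrow> ((nat \<Rightarrow> nat) \<Rightarrow> 'k) set" where
  "isotypic d j = {f \<in> Apiece d j. \<forall>\<sigma>. \<sigma> permutes {0..<3} \<longrightarrow> perm_act \<sigma> f = cscale (chi \<sigma>) f}"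

lemma isotypic_apply:
  "f \<in> isotypic d j \<Longrightarrow> \<sigma> permutes {0..<3} \<Longrightarrow> f (a \<circ> \<sigma>) = chi \<sigma> * f a"
  by (auto simp: isotypic_def perm_act_def cscale_def fun_eq_iff)

lemma subspace_isotypic: "fs.subspace (isotypic d j)"
  by (auto simp: fs.subspace_def isotypic_def Apiece_def perm_act_def cscale_def fun_eq_iff
      distrib_left)

lemma lower_isotypic: "f \<in> isotypic d (Suc j) \<Longrightarrow> lower d f \<in> isotypic d j"
  using fsp.linear_scale[OF linear_lower]
  by (auto simp: isotypic_def lower_Apiece lower_perm_act[symmetric])

lemma raise_isotypic: "f \<in> isotypic d j \<Longrightarrow> raise d f \<in> isotypic d (Suc j)"
  using fsp.linear_scale[OF linear_raise]
  by (auto simp: isotypic_def raise_Apiece raise_perm_act[symmetric])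

text \<open>To solve \<open>(E F + m) x = y\<close>, rewrite the operator as \<open>F E + c\<close> with \<open>c > 0\<close>. If
  \<open>(E F + c) z = E y\<close> in degree one less, then \<open>x = (y - F z) / c\<close> is a solution.\<close>
lemma lower_raise_plus_surj:
  assumes "2 * i < 3 * (d - 1)" "y \<in> isotypic d i"
  shows "\<exists>x\<in>isotypic d i. lower d (raise d x) + cscale (of_nat m) x = y"
  using assms
proof (induction i arbitrary: m y)
  case 0
  \<comment> \<open>In degree 0 the operator \<open>E\<close> is zero, so \<open>E F + m\<close> is
    the scalar \<open>c\<close>.\<close>
  define c :: 'k where "c = of_nat (3 * (d - 1)) + of_nat m"
  define x where "x = cscale (inverse c) y"
  have "c \<noteq> 0"
    using 0 unfolding c_def of_nat_add[symmetric] of_nat_eq_0_iff by simp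
  have x: "x \<in> isotypic d 0"
    unfolding x_def by (intro fs.subspace_scale subspace_isotypic 0)
  then have xA: "x \<in> Apiece d 0" by (simp add: isotypic_def)
  have "lower d (raise d x) = cscale (of_nat (3 * (d - 1))) x"
    using lower_raise[OF xA] by (simp add: lower_Apiece_0[OF xA] fsp.linear_0[OF linear_raise])
  then have "lower d (raise d x) + cscale (of_nat m) x = cscale c x"
    by (simp only: c_def fs.scale_left_distrib)
  also have "\<dots> = y" using \<open>c \<noteq> 0\<close> by (simp add: x_def)
  finally show ?case using x by blast
next
  case (Suc i)
  define n where "n = 3 * (d - 1) - 2 * Suc i"
  define c :: 'k where "c = of_nat n + of_nat m"
  have "c \<noteq> 0"
    using Suc.prems(1) unfolding c_def n_def of_nat_add[symmetric] of_nat_eq_0_iff by simp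
  have "2 * i < 3 * (d - 1)" using Suc.prems(1) by simp
  \<comment> \<open>In degree \<open>i\<close> the scalar to be added is \<open>n + m\<close>, which
    is why the induction runs over arbitrary \<open>m\<close>.\<close>
  from Suc.IH[OF this lower_isotypic[OF Suc.prems(2)], of "n + m"]
  obtain z where z: "z \<in> isotypic d i" "lower d (raise d z) + cscale c z = lower d y"
    unfolding c_def of_nat_add by blast
  define x where "x = cscale (inverse c) (y - raise d z)"
  have x: "x \<in> isotypic d (Suc i)"
    unfolding x_def
    by (intro fs.subspace_scale fs.subspace_diff subspace_isotypic raise_isotypic z Suc.prems)
  then have xA: "x \<in> Apiece d (Suc i)" by (simp add: isotypic_def)
  \<comment> \<open>The equation for \<open>z\<close> says \<open>E y - E F z = c z\<close>, so
    \<open>E x = z\<close>; hence \<open>F E x + c x = F z + (y - F z) = y\<close>.\<close>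
  have "lower d x = cscale (inverse c) (lower d y - lower d (raise d z))"
    by (simp only: x_def fsp.linear_scale[OF linear_lower] fsp.linear_diff[OF linear_lower])
  also have "lower d y - lower d (raise d z) = cscale c z"
    using z(2)[symmetric] by simp
  finally have "lower d x = z" using \<open>c \<noteq> 0\<close> by simp
  moreover have "lower d (raise d x) = raise d (lower d x) + cscale (of_nat n) x"
    using lower_raise[OF xA] Suc.prems(1) unfolding n_def by simp
  then have "lower d (raise d x) + cscale (of_nat m) x = raise d (lower d x) + cscale c x"
    by (simp only: c_def fs.scale_left_distrib add.assoc)
  moreover have "cscale c x = y - raise d z"
    using \<open>c \<noteq> 0\<close> by (simp add: x_def)
  ultimately have "lower d (raise d x) + cscale (of_nat m) x = y" by simp
  with x show ?case by blast
qed

text \<open>Solving \<open>E F x = y\<close>, the case \<open>m = 0\<close> above, provides the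
  preimage \<open>F x\<close>.\<close>

lemma lower_image_isotypic:
  assumes "2 * i < 3 * (d - 1)"
  shows "lower d ` isotypic d (Suc i) = isotypic d i"
proof
  show "isotypic d i \<subseteq> lower d ` isotypic d (Suc i)"
  proof
    fix y assume "y \<in> isotypic d i"
    then obtain x where "x \<in> isotypic d i" "lower d (raise d x) + cscale (of_nat 0) x = y"
      using lower_raise_plus_surj[OF assms] by blast
    then show "y \<in> lower d ` isotypic d (Suc i)"
      using raise_isotypic by auto
  qed
qed (auto simp: lower_isotypic)

text \<open>The dominant monomials whose stabilizer acts trivially through \<open>chi\<close>: exactly those with
  a nonzero \<open>chi\<close>-twisted orbit sum.\<close>
definition weights :: "nat \<Rightarrow> nat \<Rightarrow> (nat \<Rightarrow> nat) set" where
  "weights d j = {a \<in> dominant d j. \<forall>\<sigma>. \<sigma> permutes {0..<3} \<longrightarrow> a \<circ> \<sigma> = a \<longrightarrow> chi \<sigma> = 1}"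

definition orbit_sum :: "(nat \<Rightarrow> nat) \<Rightarrow> ((nat \<Rightarrow> nat) \<Rightarrow> 'k)" where
  "orbit_sum a = (\<lambda>b. \<Sum>\<tau> | \<tau> permutes {0..<3}. if b = a \<circ> \<tau> then chi \<tau> else 0)"

lemma finite_weights: "finite (weights d j)"
  by (rule finite_subset[OF _ finite_mons[of d j]]) (auto simp: weights_def dominant_def)

lemma orbit_sum_nonzero: "orbit_sum a b \<noteq> 0 \<Longrightarrow> \<exists>\<tau>. \<tau> permutes {0..<3} \<and> b = a \<circ> \<tau>"
  unfolding orbit_sum_def
  by (erule sum.not_neutral_contains_not_neutral) (auto split: if_splits)

lemma orbit_sum_isotypic:
  assumes "a \<in> mons d j"
  shows "orbit_sum a \<in> isotypic d j"
proof -
  have "orbit_sum a \<in> Apiece d j"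
    using orbit_sum_nonzero mons_comp[OF _ assms] by (fastforce simp: Apiece_def)
  moreover have "orbit_sum a (b \<circ> \<sigma>) = chi \<sigma> * orbit_sum a b" if \<sigma>: "\<sigma> permutes {0..<3}" for \<sigma> b
  proof -
    \<comment> \<open>Replacing the summation index \<open>\<tau>\<close> by
      \<open>\<tau> \<circ> \<sigma>\<close> pulls out the factor
      \<open>chi \<sigma>\<close>.\<close>
    have "b \<circ> \<sigma> = a \<circ> (\<tau> \<circ> \<sigma>) \<longleftrightarrow> b = a \<circ> \<tau>" for \<tau>
      using permutes_surj[OF \<sigma>] by (auto simp: fun_eq_iff) (metis surj_def)
    then show ?thesis
      unfolding orbit_sum_def sum_distrib_left
      by (subst sum_permutations_compose_right[OF \<sigma>]) (auto intro!: sum.cong simp: chi_comp[OF _ \<sigma>])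
  qed
  ultimately show ?thesis
    by (auto simp: isotypic_def perm_act_def cscale_def fun_eq_iff)
qed

text \<open>For a weight, each stabilizing permutation contributes 1, so the value is the order of
  the stabilizer, which contains \<open>id\<close>.\<close>

lemma orbit_sum_self:
  assumes "a \<in> weights d j"
  shows "orbit_sum a a \<noteq> 0"
proof -
  let ?S = "{\<tau>. \<tau> permutes {0..<3} \<and> a \<circ> \<tau> = a}"
  have fin: "finite {\<tau>. \<tau> permutes {0..<3::nat}}"
    by (simp add: finite_permutations)
  have "orbit_sum a a = (\<Sum>\<tau> | \<tau> permutes {0..<3}. if a \<circ> \<tau> = a then 1 else 0)"
    unfolding orbit_sum_def using assms by (intro sum.cong) (auto simp: weights_def)
  also have "\<dots> = of_nat (card ?S)"
    by (simp add: sum.inter_filter[OF fin, symmetric])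
  finally have "orbit_sum a a = of_nat (card ?S)" .
  moreover have "id \<in> ?S" by (simp add: permutes_id)
  then have "card ?S \<noteq> 0"
    using finite_subset[of ?S, OF _ fin] card_0_eq[of ?S] by blast
  ultimately show ?thesis by simp
qed

text \<open>A nonzero value of \<open>f\<close> moves to the dominant rearrangement by a nonzero
  factor. There, a stabilizing \<open>\<sigma>\<close> multiplies this value by
  \<open>chi \<sigma>\<close> and also fixes it, so \<open>chi \<sigma> = 1\<close> and the
  rearrangement is a weight.\<close>

lemma isotypic_eq_0:
  assumes f: "f \<in> isotypic d j" and 0: "\<And>a. a \<in> weights d j \<Longrightarrow> f a = 0"
  shows "f = 0"
proof
  fix a
  show "f a = 0 a"
  proof (rule ccontr)
    assume "f a \<noteq> 0 a"
    then have "f a \<noteq> 0" by simp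
    then have "a \<in> mons d j"
      using f Apiece_supp by (auto simp: isotypic_def)
    then obtain \<sigma> where \<sigma>: "\<sigma> permutes {0..<3}" "a \<circ> \<sigma> \<in> dominant d j"
      by (rule dominant_exists)
    have "chi (\<sigma> \<circ> inv \<sigma>) = chi \<sigma> * chi (inv \<sigma>)"
      using \<sigma>(1) by (intro chi_comp permutes_inv)
    then have "chi \<sigma> \<noteq> 0"
      by (auto simp: chi_id permutes_inv_o[OF \<sigma>(1)])
    then have nz: "f (a \<circ> \<sigma>) \<noteq> 0"
      using isotypic_apply[OF f \<sigma>(1)] \<open>f a \<noteq> 0\<close> by simp
    moreover have "a \<circ> \<sigma> \<in> weights d j"
      using isotypic_apply[OF f, of _ "a \<circ> \<sigma>"] \<sigma>(2) nz by (fastforce simp: weights_def)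
    ultimately show False using 0 by blast
  qed
qed

text \<open>Orbit sums of distinct weights have disjoint supports, since distinct dominant triples
  lie in distinct orbits; \<open>dual_basis\<close> then applies.\<close>

lemma dim_isotypic:
  shows "isotypic d j \<subseteq> fs.span (orbit_sum ` weights d j)"
    and "fs.dim (isotypic d j) = card (weights d j)"
proof -
  have "orbit_sum a b = 0" if "a \<in> weights d j" "b \<in> weights d j" "a \<noteq> b" for a b
  proof (rule ccontr)
    assume "orbit_sum a b \<noteq> 0"
    then obtain \<tau> where "\<tau> permutes {0..<3}" "b = a \<circ> \<tau>"
      using orbit_sum_nonzero by blast
    then have "b = a"
      using that(1,2) dominant_unique[of \<tau> a d j] by (simp add: weights_def)
    with that(3) show False by simp
  qed
  note * = subspace_isotypic finite_weights isotypic_eq_0 _ orbit_sum_self this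
  show "isotypic d j \<subseteq> fs.span (orbit_sum ` weights d j)"
    by (rule dual_basis[OF *]) (auto intro!: orbit_sum_isotypic simp: weights_def dominant_def)
  show "fs.dim (isotypic d j) = card (weights d j)"
    by (rule dual_basis[OF *]) (auto intro!: orbit_sum_isotypic simp: weights_def dominant_def)
qed

text \<open>Rank-nullity for \<open>E\<close> on the isotypic part, whose image is the whole
  isotypic part one degree lower.\<close>

lemma char_mult_kerE:
  assumes "2 * i < 3 * (d - 1)"
  shows "card (weights d (Suc i)) = char_mult chi (kerE d (Suc i)) + card (weights d i)"
proof -
  have "{f \<in> kerE d (Suc i). \<forall>\<sigma>. \<sigma> permutes {0..<3} \<longrightarrow> perm_act \<sigma> f = cscale (chi \<sigma>) f} =
        {f \<in> isotypic d (Suc i). lower d f = 0}"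
    by (auto simp: kerE_def isotypic_def Emap_eq_lower fun_eq_iff)
  then have "char_mult chi (kerE d (Suc i)) = fs.dim {f \<in> isotypic d (Suc i). lower d f = 0}"
    by (simp add: char_mult_def)
  moreover have "fs.dim (isotypic d (Suc i)) =
      fs.dim {f \<in> isotypic d (Suc i). lower d f = 0} + fs.dim (lower d ` isotypic d (Suc i))"
    by (rule fsp.dim_kernel_plus_dim_image[OF linear_lower subspace_isotypic _ dim_isotypic(1)])
      (simp add: finite_weights)
  ultimately show ?thesis
    by (simp add: lower_image_isotypic[OF assms] dim_isotypic(2))
qed

end

subsection \<open>Counting decreasing triples\<close>

text \<open>The gap \<open>s\<close> covers both characters: \<open>s = 0\<close> gives the weakly
  decreasing triples (trivial), \<open>s = 1\<close> the strictly decreasing ones (sign).\<close>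

definition decreasing :: "nat \<Rightarrow> nat \<Rightarrow> nat \<Rightarrow> (nat \<Rightarrow> nat) set" where
  "decreasing s d j = {a \<in> mons d j. a 2 + s \<le> a 1 \<and> a 1 + s \<le> a 0}"

lemma finite_decreasing: "finite (decreasing s d j)"
  by (rule finite_subset[OF _ finite_mons[of d j]]) (auto simp: decreasing_def)

text \<open>Incrementing the largest exponent maps the decreasing triples of degree \<open>j\<close>
  injectively to those of degree \<open>j + 1\<close>; it fails on \<open>a 0 = d - 1\<close> and misses \<open>a 0 = a 1 + s\<close>.\<close>
lemma card_decreasing_Suc:
  "card (decreasing s d (Suc j)) + card {a \<in> decreasing s d j. a 0 = d - 1} =
   card (decreasing s d j) + card {a \<in> decreasing s d (Suc j). a 0 = a 1 + s}"
proof -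
  let ?A = "{a \<in> decreasing s d j. a 0 \<noteq> d - 1}"
  let ?B = "{a \<in> decreasing s d (Suc j). a 0 \<noteq> a 1 + s}"
  have "bij_betw (\<lambda>a. a(0 := a 0 + 1)) ?A ?B"
    by (rule bij_betw_byWitness[where f' = "\<lambda>a. a(0 := a 0 - 1)"])
      (auto simp: decreasing_def mons_def all_less_3)
  then have AB: "card ?A = card ?B" by (rule bij_betw_same_card)
  have split: "card (decreasing s d n) =
      card {a \<in> decreasing s d n. P a} + card {a \<in> decreasing s d n. \<not> P a}" for n P
    by (subst card_Un_disjoint[symmetric])
      (auto simp: finite_decreasing intro: arg_cong[where f = card])
  show ?thesis
    using split[of j "\<lambda>a. a 0 = d - 1"] split[of "Suc j" "\<lambda>a. a 0 = a 1 + s"] AB by simp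
qed

text \<open>With \<open>a 0 = d - 1\<close> the other two exponents add up to
  \<open>Suc j - d\<close>, so \<open>c = a 2\<close> determines the triple, and
  \<open>a 2 + s <= a 1\<close> becomes the stated inequality. The degree bound forces
  \<open>a 1 + s <= d - 1\<close>.\<close>

lemma card_decreasing_top:
  assumes "d \<le> Suc j" "2 * Suc j \<le> 3 * (d - 1)" "s \<le> 1"
  shows "card {a \<in> decreasing s d j. a 0 = d - 1} = card {c. 2 * c + s \<le> Suc j - d}"
proof (rule bij_betw_same_card)
  let ?g = "\<lambda>c. (\<lambda>_. 0)(0 := d - 1, 1 := Suc j - d - c, 2 := c)"
  show "bij_betw (\<lambda>a. a 2) {a \<in> decreasing s d j. a 0 = d - 1} {c. 2 * c + s \<le> Suc j - d}"
  proof (rule bij_betw_byWitness[where f' = ?g])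
    show "\<forall>a\<in>{a \<in> decreasing s d j. a 0 = d - 1}. ?g (a 2) = a"
    proof
      fix a assume a: "a \<in> {a \<in> decreasing s d j. a 0 = d - 1}"
      show "?g (a 2) = a"
      proof
        fix i :: nat
        consider "i = 0" | "i = 1" | "i = 2" | "i \<ge> 3" by linarith
        then show "?g (a 2) i = a i"
          using a assms by cases (auto simp: decreasing_def mons_def)
      qed
    qed
  qed (use assms in \<open>auto simp: decreasing_def mons_def all_less_3\<close>)
qed

text \<open>With \<open>b = a 1\<close> the triple is \<open>(b + s, b, j - s - 2 * b)\<close>.
  Nonnegativity of the last entry is the first inequality, and \<open>a 2 + s <= a 1\<close> is the
  second; the degree bound gives \<open>b + s < d\<close>.\<close>

lemma card_decreasing_diagonal:
  assumes "2 * j \<le> 3 * (d - 1)" "3 \<le> d" "s \<le> 1"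
  shows "card {a \<in> decreasing s d j. a 0 = a 1 + s} = card {b. 2 * b + s \<le> j \<and> j \<le> 3 * b}"
proof (rule bij_betw_same_card)
  let ?g = "\<lambda>b. (\<lambda>_. 0)(0 := b + s, 1 := b, 2 := j - s - 2 * b)"
  show "bij_betw (\<lambda>a. a 1) {a \<in> decreasing s d j. a 0 = a 1 + s} {b. 2 * b + s \<le> j \<and> j \<le> 3 * b}"
  proof (rule bij_betw_byWitness[where f' = ?g])
    show "\<forall>a\<in>{a \<in> decreasing s d j. a 0 = a 1 + s}. ?g (a 1) = a"
    proof
      fix a assume a: "a \<in> {a \<in> decreasing s d j. a 0 = a 1 + s}"
      show "?g (a 1) = a"
      proof
        fix i :: nat
        consider "i = 0" | "i = 1" | "i = 2" | "i \<ge> 3" by linarith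
        then show "?g (a 1) i = a i"
          using a assms by cases (auto simp: decreasing_def mons_def)
      qed
    qed
  qed (use assms in \<open>auto simp: decreasing_def mons_def all_less_3\<close>)
qed

lemma card_le_half: "s \<le> 1 \<Longrightarrow> card {c::nat. 2 * c + s \<le> n} = (n + 2 - s) div 2"
proof -
  assume "s \<le> 1"
  then have "{c::nat. 2 * c + s \<le> n} = {..<(n + 2 - s) div 2}" by auto
  then show ?thesis by simp
qed

text \<open>The values of \<open>b\<close> form an interval whose lower end
  \<open>(j + 2) div 3\<close> is the ceiling of j/3.\<close>

lemma card_half_third:
  "s \<le> 1 \<Longrightarrow> card {b::nat. 2 * b + s \<le> j \<and> j \<le> 3 * b} = (j + 2 - s) div 2 - (j + 2) div 3"
proof -
  assume "s \<le> 1"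
  then have "{b::nat. 2 * b + s \<le> j \<and> j \<le> 3 * b} = {(j + 2) div 3..<(j + 2 - s) div 2}" by auto
  then show ?thesis by simp
qed

subsection \<open>The two multiplicities\<close>

interpretation trivial_char: s3_character "\<lambda>_. 1 :: 'k::field_char_0"
  by unfold_locales simp_all

lemma trivial_char_weights: "trivial_char.weights TYPE('k::field_char_0) d j = decreasing 0 d j"
  by (auto simp: trivial_char.weights_def decreasing_def dominant_def)

interpretation sign_char: s3_character "\<lambda>\<sigma>. of_int (sign \<sigma>) :: 'k::field_char_0"
proof
  fix \<sigma> \<tau> :: "nat \<Rightarrow> nat"
  assume "\<sigma> permutes {0..<3}" "\<tau> permutes {0..<3}"
  then have "permutation \<sigma>" "permutation \<tau>"
    by (auto intro: permutation_permutes[THEN iffD2] exI[of _ "{0..<3}"])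
  then show "of_int (sign (\<sigma> \<circ> \<tau>)) = (of_int (sign \<sigma>) * of_int (sign \<tau>) :: 'k)"
    by (simp add: sign_compose)
qed simp

text \<open>Two equal exponents are exchanged by a transposition, which stabilizes the triple and
  has sign -1; a strictly decreasing triple has trivial stabilizer.\<close>

lemma sign_char_weights: "sign_char.weights TYPE('k::field_char_0) d j = decreasing 1 d j"
proof (intro equalityI subsetI)
  fix a assume a: "a \<in> sign_char.weights TYPE('k) d j"
  have "a \<circ> transpose x y \<noteq> a" if "x < 3" "y < 3" "x \<noteq> y" for x y
  proof
    have "transpose x y permutes {0..<3}"
      using that by (auto intro: permutes_swap_id)
    moreover assume "a \<circ> transpose x y = a"
    ultimately have "of_int (sign (transpose x y)) = (1 :: 'k)"
      using a unfolding sign_char.weights_def by blast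
    then show False using that(3) by (simp add: sign_swap_id)
  qed
  moreover have "a \<circ> transpose x y = a" if "a x = a y" for x y
    using that by (auto simp: fun_eq_iff transpose_def)
  ultimately have ne: "a x \<noteq> a y" if "x < 3" "y < 3" "x \<noteq> y" for x y
    using that by blast
  show "a \<in> decreasing 1 d j"
    using a ne[of 0 1] ne[of 1 2] by (auto simp: sign_char.weights_def decreasing_def dominant_def)
next
  fix a assume a: "a \<in> decreasing 1 d j"
  have stab: "\<sigma> = id" if \<sigma>: "\<sigma> permutes {0..<3}" and "a \<circ> \<sigma> = a" for \<sigma>
  proof
    fix i :: nat
    have *: "a (\<sigma> i) = a i" for i
      using fun_cong[OF \<open>a \<circ> \<sigma> = a\<close>, of i] by simp
    have "a 2 < a 1" "a 1 < a 0"
      using a by (auto simp: decreasing_def)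
    then have "\<sigma> 0 = 0 \<and> \<sigma> 1 = 1 \<and> \<sigma> 2 = 2"
      using permutes_3_cases(1)[OF \<sigma>] *[of 0] *[of 1] *[of 2] by auto
    moreover consider "i = 0" | "i = 1" | "i = 2" | "i \<ge> 3" by linarith
    ultimately show "\<sigma> i = id i"
      using permutes_3_cases(2)[OF \<sigma>] by cases auto
  qed
  show "a \<in> sign_char.weights TYPE('k) d j"
    using a by (auto simp: sign_char.weights_def decreasing_def dominant_def dest: stab)
qed

section \<open>From the counts to the floor formulas\<close>

lemma mult_plus_card_top_eq:
  assumes "3 \<le> d" "d \<le> j" "2 * j \<le> 3 * (d - 1)" "s \<le> 1"
    and "card (decreasing s d j) = t + card (decreasing s d (j - 1))"
  shows "t + (j - d + 2 - s) div 2 + (j + 2) div 3 = (j + 2 - s) div 2"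
proof -
  obtain i where i: "j = Suc i" using assms by (cases j) auto
  \<comment> \<open>As \<open>t\<close> is the growth of the count from degree \<open>j - 1\<close>
    to \<open>j\<close>, it equals the triples missed by incrementing \<open>a 0\<close> minus those
    where incrementing fails.\<close>
  have "t + card {a \<in> decreasing s d i. a 0 = d - 1} =
      card {a \<in> decreasing s d j. a 0 = a 1 + s}"
    using card_decreasing_Suc[of s d i] assms(5) by (simp add: i)
  also have "card {a \<in> decreasing s d i. a 0 = d - 1} = (j - d + 2 - s) div 2"
    using card_decreasing_top[of d i s] assms(2-4) by (simp only: i card_le_half)
  also have "card {a \<in> decreasing s d j. a 0 = a 1 + s} = (j + 2 - s) div 2 - (j + 2) div 3"
    using card_decreasing_diagonal[OF assms(3,1,4)] assms(4) by (simp only: card_half_third)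
  finally have "t + (j - d + 2 - s) div 2 = (j + 2 - s) div 2 - (j + 2) div 3" .
  \<comment> \<open>This makes the natural subtraction exact, so the term can be moved to the other
    side.\<close>
  moreover have "(j + 2) div 3 \<le> (j + 1) div 2" by linarith
  then have "(j + 2) div 3 \<le> (j + 2 - s) div 2"
    using assms(4) div_le_mono[of "j + 1" "j + 2 - s" 2] by linarith
  ultimately show ?thesis by simp
qed

lemma triv_eq:
  fixes K :: "'k::field_char_0 itself"
  assumes "3 \<le> d" "d \<le> j" "2 * j \<le> 3 * (d - 1)"
  shows "triv K d j + (j - d + 2) div 2 + (j + 2) div 3 = (j + 2) div 2"
proof -
  obtain i where i: "j = Suc i" using assms by (cases j) auto
  have "card (decreasing 0 d j) = triv K d j + card (decreasing 0 d (j - 1))"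
    using trivial_char.char_mult_kerE[of i d, where 'k = 'k] assms by (simp add: i trivial_char_weights triv_def)
  from mult_plus_card_top_eq[OF assms _ this] show ?thesis by simp
qed

lemma sign_mult_eq:
  fixes K :: "'k::field_char_0 itself"
  assumes "3 \<le> d" "d \<le> j" "2 * j \<le> 3 * (d - 1)"
  shows "sign_mult K d j + (j - d + 1) div 2 + (j + 2) div 3 = (j + 1) div 2"
proof -
  obtain i where i: "j = Suc i" using assms by (cases j) auto
  have "card (decreasing 1 d j) = sign_mult K d j + card (decreasing 1 d (j - 1))"
    using sign_char.char_mult_kerE[of i d, where 'k = 'k] assms
    by (simp add: i sign_char_weights sign_mult_def)
  from mult_plus_card_top_eq[OF assms _ this] show ?thesis by simp
qed

text \<open>Both floors in the theorem take this form once \<open>d\<close> is written as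
  \<open>2 * e\<close> or \<open>2 * e + 1\<close>; \<open>(j + 2) div 3\<close> is the ceiling of
  j/3.\<close>

lemma floor_minus_third: "\<lfloor>real e - real j / 3\<rfloor> = int e - int ((j + 2) div 3)"
proof (rule floor_unique)
  have "j \<le> 3 * ((j + 2) div 3)" "3 * ((j + 2) div 3) \<le> j + 2" by linarith+
  then have "real j \<le> 3 * real ((j + 2) div 3)" "3 * real ((j + 2) div 3) \<le> real j + 2"
    by linarith+
  then show "real_of_int (int e - int ((j + 2) div 3)) \<le> real e - real j / 3"
    and "real e - real j / 3 < real_of_int (int e - int ((j + 2) div 3)) + 1"
    by simp_all
qed

theorem theorem5p2:
  fixes K :: "'k::{alg_closed_field, field_char_0} itself"
    and d j :: nat
  assumes "d \<ge> 3" and "d \<le> j" and "j \<le> (3 * (d - 1)) div 2"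
  shows "(odd d \<and> even (j - d) \<longrightarrow>
            int (triv K d j) = \<lfloor>(3 * real d - 2 * real j - 3) / 6\<rfloor> \<and>
            int (sign_mult K d j) = \<lfloor>(3 * real d - 2 * real j - 3) / 6\<rfloor> + 1)
       \<and> (odd d \<and> odd (j - d) \<longrightarrow>
            int (triv K d j) = \<lfloor>(3 * real d - 2 * real j - 3) / 6\<rfloor> + 1 \<and>
            int (sign_mult K d j) = \<lfloor>(3 * real d - 2 * real j - 3) / 6\<rfloor>)
       \<and> (even d \<longrightarrow>
            int (triv K d j) = \<lfloor>(3 * real d - 2 * real j) / 6\<rfloor> \<and>
            int (sign_mult K d j) = \<lfloor>(3 * real d - 2 * real j) / 6\<rfloor>)"
proof -
  have j: "2 * j \<le> 3 * (d - 1)" using assms(3) by simp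
  define m where "m = j - d"
  have jm: "j = d + m" using assms(2) by (simp add: m_def)
  note mult = triv_eq[OF assms(1,2) j, of K] sign_mult_eq[OF assms(1,2) j, of K]
  show ?thesis
  proof (cases "even d")
    case True
    then obtain e where e: "d = 2 * e" by blast
    have "(3 * real d - 2 * real j) / 6 = real e - real j / 3"
      by (simp add: e field_simps)
    then have "\<lfloor>(3 * real d - 2 * real j) / 6\<rfloor> = int e - int ((j + 2) div 3)"
      by (simp only: floor_minus_third)
    \<comment> \<open>Shifting by \<open>d = 2 * e\<close> changes either half by exactly
      \<open>e\<close>, so both multiplicities equal \<open>e\<close> minus the ceiling of
      j/3.\<close>
    moreover have "(j + 2) div 2 = e + (j - d + 2) div 2" "(j + 1) div 2 = e + (j - d + 1) div 2"
      by (simp_all add: jm e)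
    ultimately show ?thesis using mult True by simp
  next
    case False
    then obtain e where e: "d = 2 * e + 1" by (rule oddE)
    have "(3 * real d - 2 * real j - 3) / 6 = real e - real j / 3"
      by (simp add: e field_simps)
    then have fl: "\<lfloor>(3 * real d - 2 * real j - 3) / 6\<rfloor> = int e - int ((j + 2) div 3)"
      by (simp only: floor_minus_third)
    \<comment> \<open>For odd \<open>d\<close> the shift changes one of the halves by
      \<open>e\<close> and the other by \<open>e + 1\<close>. The extra 1 goes to the sign character
      if \<open>j - d\<close> is even and to the trivial one if it is odd.\<close>
    show ?thesis
    proof (cases "even (j - d)")
      case True
      then obtain n where "m = 2 * n" unfolding m_def by blast
      then have "(j + 2) div 2 = e + (j - d + 2) div 2" "(j + 1) div 2 = e + 1 + (j - d + 1) div 2"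
        by (simp_all add: jm e)
      then show ?thesis using mult True \<open>odd d\<close> fl by simp
    next
      case odd: False
      then obtain n where "m = 2 * n + 1" unfolding m_def by (rule oddE)
      then have "(j + 2) div 2 = e + 1 + (j - d + 2) div 2" "(j + 1) div 2 = e + (j - d + 1) div 2"
        by (simp_all add: jm e)
      then show ?thesis using mult odd \<open>odd d\<close> fl by simp
    qed
  qed
qed

end
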